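(* Let $\{\varphi_n(z)\}_{n\ge 0}$ be the orthonormal rational functions described in the context (with $\varphi_0=1$, numerators $r_n$, and all regularity assumptions listed there), and put $\varphi_{-1}(z):=0$. Then there exist constants $e_j,d_j\in\mathbb{C}$ and $c_j\in\mathbb{C}\setminus\{0\}$, $j\ge 1$, such that for all $n\ge 0$ (with $\beta_0:=0$) $$\varphi_{2n+1}(z)=\left[\frac{e_{2n+1}}{z-\alpha_{n+1}}+\frac{d_{2n+1}(z-\beta_n)}{z-\alpha_{n+1}}\right]\varphi_{2n}(z)+c_{2n+1}\frac{1-z\bar\alpha_n}{z-\alpha_{n+1}}\varphi_{2n-1}(z),$$ $$\varphi_{2n+2}(z)=\left[\frac{e_{2n+2}}{1-z\bar\beta_{n+1}}+\frac{d_{2n+2}(1-z\bar\alpha_{n+1})}{1-z\bar\beta_{n+1}}\right]\varphi_{2n+1}(z)+c_{2n+2}\frac{z-\beta_n}{1-z\bar\beta_{n+1}}\varphi_{2n}(z).$$ (For $n=0$ the last term of the first relation is absent because $\varphi_{-1}=0$, so $c_1$ may be any nonzero number and no $\alpha_0$ is needed.)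
   Context: Let $\{\alpha_j\}_{j\ge1}$ and $\{\beta_j\}_{j\ge1}$ be sequences in $\mathbb{C}\setminus\{0\}$ and $\beta_0:=0$. Define, for $j\ge0$, $$\mathfrak{u}_{2j}(z)=\frac{z^{2j}}{\prod_{k=1}^{j}(z-\alpha_k)\prod_{k=1}^{j}(1-z\bar\beta_k)},\qquad \mathfrak{u}_{2j+1}(z)=\frac{z}{z-\alpha_{j+1}}\mathfrak{u}_{2j}(z),$$ $\mathcal{L}_n=\mathrm{span}\{\mathfrak{u}_0,\dots,\mathfrak{u}_n\}$, $\mathcal{L}=\bigcup_n\mathcal{L}_n$. (Thus $\mathcal{L}_{2n}$ is the space of functions $p(z)/(\prod_{k=1}^n(z-\alpha_k)\prod_{k=1}^n(1-z\bar\beta_k))$ with $\deg p\le 2n$, and $\mathcal{L}_{2n+1}$ is the space of functions $p(z)/(\prod_{k=1}^{n+1}(z-\alpha_k)\prod_{k=1}^n(1-z\bar\beta_k))$ with $\deg p\le 2n+1$.) For a rational function $h$ put $h_*(z)=\overline{h(1/\bar z)}$. Let $\mathfrak{L}$ be a linear functional on the linear span of the products $f g_*$, $f,g\in\mathcal{L}$, which is Hermitian, $\mathfrak{L}(h_* )=\overline{\mathfrak{L}(h)}$, and positive definite, $\mathfrak{L}(hh_* )>0$ for $0\ne h\in\mathcal{L}$, so that $\langle f,g\rangle:=\mathfrak{L}(f g_* )$ is an inner product on $\mathcal{L}$; it is normalized by $\mathfrak{L}(1)=1$. Let $\{\varphi_n\}_{n\ge0}$ be the orthonormal sequence, $\langle\varphi_m,\varphi_n\rangle=\delta_{m,n}$,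 obtained by Gram–Schmidt from $\mathfrak{u}_0,\mathfrak{u}_1,\dots$, with $\varphi_0=1$. Write $$\varphi_{2j}(z)=\frac{r_{2j}(z)}{\prod_{k=1}^{j}(z-\alpha_k)\prod_{k=1}^{j}(1-z\bar\beta_k)},\qquad \varphi_{2j+1}(z)=\frac{r_{2j+1}(z)}{\prod_{k=1}^{j+1}(z-\alpha_k)\prod_{k=1}^{j}(1-z\bar\beta_k)},$$ where $r_n$ is a polynomial of degree at most $n$, $r_0=1$. Standing regularity assumptions: $r_{2n}(\alpha_n)\ne0$, $r_{2n}(1/\bar\beta_n)\ne0$, $r_{2n}(\beta_{n-1})\neq0$, $r_{2n}(1/\bar\alpha_n)\ne0$ for $n\ge1$; $r_{2n+1}(\alpha_{n+1})\ne0$, $r_{2n+1}(\beta_n)\ne0$ for $n\ge0$; and $r_{2n+1}(1/\bar\beta_n)\ne0$, $r_{2n+1}(1/\bar\alpha_n)\ne0$ for $n\ge1$. *)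

theory Defs
  imports
    "HOL-Computational_Algebra.Computational_Algebra"
    "HOL-Computational_Algebra.Field_as_Ring"
begin

text \<open>
  Rational functions over \<open>\<complex>\<close> are elements of the fraction field \<open>complex poly fract\<close>, not
  functions \<open>complex \<Rightarrow> complex\<close>, so that equality of rational functions does not depend on the
  values HOL assigns at poles (or to \<open>h (1 / cnj z)\<close> at \<open>z = 0\<close>).
\<close>

type_synonym ratfun = "complex poly fract"

definition rconst :: "complex \<Rightarrow> ratfun" where
  "rconst c = to_fract [:c:]"

definition rvar :: ratfun where
  "rvar = to_fract [:0, 1:]"

definition rscale :: "complex \<Rightarrow> ratfun \<Rightarrow> ratfun" where
  "rscale c f = rconst c * f"

interpretation ratfun: vector_space rscale
proof
  have add: "rconst (a + b) = rconst a + rconst b" for a b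
    unfolding rconst_def to_fract_add[symmetric] by simp
  have mult: "rconst (a * b) = rconst a * rconst b" for a b
    unfolding rconst_def to_fract_mult[symmetric] by simp
  fix a b :: complex and x y :: ratfun
  show "rscale a (x + y) = rscale a x + rscale a y"
    by (simp add: rscale_def algebra_simps)
  show "rscale (a + b) x = rscale a x + rscale b x"
    by (simp add: rscale_def add algebra_simps)
  show "rscale a (rscale b x) = rscale (a * b) x"
    by (simp add: rscale_def mult algebra_simps)
  show "rscale 1 x = x"
    unfolding rscale_def rconst_def one_pCons[symmetric] by simp
qed

text \<open>
  The substar conjugate \<open>h\<^sub>*(z) = cnj (h (1 / cnj z))\<close>. For a polynomial \<open>p\<close> of degree \<open>d\<close>,
  \<open>cnj (p (1 / cnj z)) = p\<^sup>*(z) / z ^ d\<close>, where \<open>p\<^sup>*\<close> is obtained from \<open>p\<close> by conjugating the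
  coefficients and reversing their order; clearing denominators in \<open>p\<^sub>* / q\<^sub>*\<close> gives the formula
  below. It does not depend on the representation \<open>h = p / q\<close> (\<open>substar_Fract\<close>), and
  \<open>substar_eval\<close> confirms the defining equation pointwise.
\<close>

definition recip_conj :: "complex poly \<Rightarrow> complex poly" where
  "recip_conj p = reflect_poly (map_poly cnj p)"

lemma map_poly_cnj_mult: "map_poly cnj (p * q) = map_poly cnj p * map_poly cnj q"
  by (intro poly_eqI) (simp add: coeff_map_poly coeff_mult)

lemma recip_conj_mult: "recip_conj (p * q) = recip_conj p * recip_conj q"
  by (simp add: recip_conj_def map_poly_cnj_mult reflect_poly_mult)

lemma recip_conj_eq_0_iff [simp]: "recip_conj p = 0 \<longleftrightarrow> p = 0"
  by (simp add: recip_conj_def map_poly_eq_0_iff)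

lemma poly_recip_conj:
  assumes "z \<noteq> 0"
  shows "poly (recip_conj p) z = z ^ degree p * cnj (poly p (1 / cnj z))"
proof -
  have "degree (map_poly cnj p) = degree p"
    by (rule degree_map_poly) simp
  moreover have "poly (map_poly cnj p) (1 / z) = cnj (poly p (1 / cnj z))"
    unfolding poly_cnj by simp
  ultimately show ?thesis
    unfolding recip_conj_def poly_reflect_poly_nz[OF assms] inverse_eq_divide by simp
qed

definition substar :: "ratfun \<Rightarrow> ratfun" where
  "substar h = (case quot_of_fract h of (p, q) \<Rightarrow>
     Fract (recip_conj p * monom 1 (degree q)) (recip_conj q * monom 1 (degree p)))"

lemma substar_Fract:
  assumes "q \<noteq> 0"
  shows "substar (Fract p q) =
    Fract (recip_conj p * monom 1 (degree q)) (recip_conj q * monom 1 (degree p))"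
proof -
  obtain r s where rs: "quot_of_fract (Fract p q) = (r, s)"
    by (cases "quot_of_fract (Fract p q)")
  have s: "s \<noteq> 0"
    using snd_quot_of_fract_nonzero[of "Fract p q"] rs by simp
  have "Fract r s = Fract p q"
    using quot_to_fract_quot_of_fract[of "Fract p q"] rs by (simp add: quot_to_fract_def)
  with s assms have eq: "p * s = r * q" by (simp add: eq_fract)
  have "recip_conj r * monom 1 (degree s) * (recip_conj q * monom 1 (degree p)) =
        recip_conj p * monom 1 (degree q) * (recip_conj s * monom 1 (degree r))"
  proof (cases "p = 0")
    case True
    with eq assms have "r = 0" by simp
    with True show ?thesis by (simp add: recip_conj_def)
  next
    case False
    with eq s have r: "r \<noteq> 0" by auto
    have "degree p + degree s = degree r + degree q"
      using eq degree_mult_eq[OF False s] degree_mult_eq[OF r assms] by simp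
    then have m: "monom (1::complex) (degree s) * monom 1 (degree p) =
        monom 1 (degree q) * monom 1 (degree r)"
      by (simp add: mult_monom add.commute)
    have c: "recip_conj r * recip_conj q = recip_conj p * recip_conj s"
      unfolding recip_conj_mult[symmetric] eq ..
    have "recip_conj r * monom 1 (degree s) * (recip_conj q * monom 1 (degree p)) =
        (recip_conj r * recip_conj q) * (monom 1 (degree s) * monom 1 (degree p))"
      by (simp only: mult_ac)
    also have "\<dots> = recip_conj p * monom 1 (degree q) * (recip_conj s * monom 1 (degree r))"
      unfolding c m by (simp only: mult_ac)
    finally show ?thesis .
  qed
  with s assms show ?thesis
    by (simp add: substar_def rs eq_fract)
qed

lemma substar_eval:
  assumes "q \<noteq> 0" "z \<noteq> 0" "poly q (1 / cnj z) \<noteq> 0"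
  obtains p' q' where "substar (Fract p q) = Fract p' q'" "poly q' z \<noteq> 0"
    "poly p' z / poly q' z = cnj (poly p (1 / cnj z) / poly q (1 / cnj z))"
proof
  show "substar (Fract p q) =
      Fract (recip_conj p * monom 1 (degree q)) (recip_conj q * monom 1 (degree p))"
    using assms(1) by (rule substar_Fract)
qed (use assms in \<open>simp_all add: poly_recip_conj poly_monom\<close>)

text \<open>
  Only the entries \<open>\<alpha> k\<close>, \<open>\<beta> k\<close> with \<open>k \<ge> 1\<close> enter the basis functions.
\<close>

definition ubasis :: "(nat \<Rightarrow> complex) \<Rightarrow> (nat \<Rightarrow> complex) \<Rightarrow> nat \<Rightarrow> ratfun" where
  "ubasis \<alpha> \<beta> n =
    (let j = n div 2;
         v = rvar ^ (2 * j) / ((\<Prod>k=1..j. rvar - rconst (\<alpha> k)) *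
                               (\<Prod>k=1..j. 1 - rvar * rconst (cnj (\<beta> k))))
     in if even n then v else rvar / (rvar - rconst (\<alpha> (j + 1))) * v)"

definition Lspace_upto :: "(nat \<Rightarrow> complex) \<Rightarrow> (nat \<Rightarrow> complex) \<Rightarrow> nat \<Rightarrow> ratfun set" where
  "Lspace_upto \<alpha> \<beta> n = ratfun.span (ubasis \<alpha> \<beta> ` {..n})"

definition Lspace :: "(nat \<Rightarrow> complex) \<Rightarrow> (nat \<Rightarrow> complex) \<Rightarrow> ratfun set" where
  "Lspace \<alpha> \<beta> = (\<Union>n. Lspace_upto \<alpha> \<beta> n)"

definition LLstar :: "(nat \<Rightarrow> complex) \<Rightarrow> (nat \<Rightarrow> complex) \<Rightarrow> ratfun set" where
  "LLstar \<alpha> \<beta> = ratfun.span {f * substar g |f g. f \<in> Lspace \<alpha> \<beta> \<and> g \<in> Lspace \<alpha> \<beta>}"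

text \<open>
  A functional on a subspace \<open>V\<close> is a total HOL function whose values outside \<open>V\<close> are irrelevant.
\<close>

definition linear_functional_on :: "ratfun set \<Rightarrow> (ratfun \<Rightarrow> complex) \<Rightarrow> bool" where
  "linear_functional_on V F \<longleftrightarrow>
    (\<forall>f\<in>V. \<forall>g\<in>V. F (f + g) = F f + F g) \<and> (\<forall>c. \<forall>f\<in>V. F (rscale c f) = c * F f)"

definition hermitian_on :: "ratfun set \<Rightarrow> (ratfun \<Rightarrow> complex) \<Rightarrow> bool" where
  "hermitian_on V F \<longleftrightarrow> (\<forall>h\<in>V. F (substar h) = cnj (F h))"

definition positive_definite_on :: "ratfun set \<Rightarrow> (ratfun \<Rightarrow> complex) \<Rightarrow> bool" where
  "positive_definite_on V F \<longleftrightarrow>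
    (\<forall>h\<in>V. h \<noteq> 0 \<longrightarrow> F (h * substar h) \<in> \<real> \<and> Re (F (h * substar h)) > 0)"

definition rinner :: "(ratfun \<Rightarrow> complex) \<Rightarrow> ratfun \<Rightarrow> ratfun \<Rightarrow> complex" where
  "rinner F f g = F (f * substar g)"

definition orthonormal_seq :: "(ratfun \<Rightarrow> complex) \<Rightarrow> (nat \<Rightarrow> ratfun) \<Rightarrow> bool" where
  "orthonormal_seq F \<phi> \<longleftrightarrow> (\<forall>m n. rinner F (\<phi> m) (\<phi> n) = (if m = n then 1 else 0))"

text \<open>
  The Gram--Schmidt step. The normalising factor \<open>\<kappa>\<close> is fixed by orthonormality up to a
  unimodular constant; that constant is left free (\<open>\<kappa> > 0\<close> is the usual choice).
\<close>

definition gram_schmidt_of ::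
    "(ratfun \<Rightarrow> complex) \<Rightarrow> (nat \<Rightarrow> ratfun) \<Rightarrow> (nat \<Rightarrow> ratfun) \<Rightarrow> bool" where
  "gram_schmidt_of F u \<phi> \<longleftrightarrow>
    (\<forall>n. \<exists>\<kappa>. \<phi> n = rscale \<kappa> (u n - (\<Sum>k<n. rscale (rinner F (u n) (\<phi> k)) (\<phi> k))))"

end

theory Submission
  imports Defs
begin

text \<open>
  The poles are put into a single sequence of linear factors \<open>\<ell>\<^sub>k = a\<^sub>k + b\<^sub>k z\<close> with reversed
  factors \<open>\<ell>\<^sub>k\<^sup>* = z (\<ell>\<^sub>k)\<^sub>*\<close>; both relations then read
  \<open>\<ell>\<^bsub>n+1\<^esub> \<phi>\<^bsub>n+1\<^esub> = (e + d \<ell>\<^sub>n\<^sup>*) \<phi>\<^sub>n + c \<ell>\<^bsub>n-1\<^esub>\<^sup>* \<phi>\<^bsub>n-1\<^esub>\<close>.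
  In terms of numerators, \<open>e\<close> and \<open>d\<close> are chosen by interpolation at the zeros of \<open>\<ell>\<^bsub>n-1\<^esub>\<^sup>*\<close> and \<open>\<ell>\<^sub>n\<close>
  (of Hermite type if they coincide), which makes the remainder \<open>\<ell>\<^bsub>n-1\<^esub>\<^sup>* g\<close> with
  \<open>g \<in> \<L>\<^bsub>n-1\<^esub>\<close>. Moving linear factors to the other side of the inner product exchanges \<open>\<ell>\<^sub>k\<close> and
  \<open>\<ell>\<^sub>k\<^sup>*\<close>, so \<open>g\<close> is orthogonal to \<open>\<L>\<^bsub>n-2\<^esub>\<close> and hence a multiple of \<open>\<phi>\<^bsub>n-1\<^esub>\<close>. If it vanished,
  testing against \<open>z p / (\<ell>\<^sub>1 \<cdots> \<ell>\<^sub>n)\<close> with \<open>deg p < n\<close> would make \<open>\<phi>\<^sub>n\<close> orthogonal to these functions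
  as well as to \<open>\<L>\<^bsub>n-1\<^esub>\<close>, thus to \<open>\<L>\<^sub>n\<close>, because \<open>e \<noteq> 0\<close> by regularity.
\<close>

section \<open>The substar conjugation as a field homomorphism, and linear interpolation\<close>

lemma rconst_0 [simp]: "rconst 0 = 0"
  by (simp add: rconst_def)

lemma rconst_1 [simp]: "rconst 1 = 1"
  unfolding rconst_def one_pCons[symmetric] by simp

lemma rconst_add: "rconst (a + b) = rconst a + rconst b"
  unfolding rconst_def to_fract_add[symmetric] by simp

lemma rconst_mult: "rconst (a * b) = rconst a * rconst b"
  unfolding rconst_def to_fract_mult[symmetric] by simp

lemma rconst_minus: "rconst (- a) = - rconst a"
  using rconst_add[of a "- a"] by (simp add: eq_neg_iff_add_eq_0 add.commute)

lemma rconst_eq_0_iff [simp]: "rconst a = 0 \<longleftrightarrow> a = 0"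
  by (simp add: rconst_def)

lemma rvar_nonzero [simp]: "rvar \<noteq> 0"
  by (simp add: rvar_def)

lemma to_fract_pCons: "to_fract (pCons a p) = rconst a + rvar * to_fract p"
  unfolding rconst_def rvar_def to_fract_mult[symmetric] to_fract_add[symmetric] by simp

lemma to_fract_conv_poly: "to_fract p = poly (map_poly rconst p) rvar"
  by (induction p) (simp_all add: to_fract_pCons map_poly_pCons)

text \<open>The substar of a polynomial, as a value at 1/z in the fraction field: unlike
  \<open>recip_conj\<close> it is additive as well as multiplicative.\<close>

definition star_poly :: "complex poly \<Rightarrow> ratfun" where
  "star_poly p = poly (map_poly (\<lambda>c. rconst (cnj c)) p) (inverse rvar)"

lemma star_poly_0 [simp]: "star_poly 0 = 0"
  by (simp add: star_poly_def)

lemma star_poly_pCons [simp]: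
  "star_poly (pCons a p) = rconst (cnj a) + inverse rvar * star_poly p"
  by (simp add: star_poly_def map_poly_pCons)

lemma star_poly_add: "star_poly (p + q) = star_poly p + star_poly q"
  by (induction p q rule: poly_induct2) (simp_all add: rconst_add algebra_simps)

lemma star_poly_smult: "star_poly (smult c p) = rconst (cnj c) * star_poly p"
  by (induction p) (simp_all add: rconst_mult algebra_simps)

lemma star_poly_mult: "star_poly (p * q) = star_poly p * star_poly q"
  by (induction p) (simp_all add: star_poly_add star_poly_smult algebra_simps)

lemma to_fract_recip_conj: "to_fract (recip_conj p) = rvar ^ degree p * star_poly p"
proof -
  let ?q = "map_poly cnj p"
  have "degree (map_poly rconst ?q) = degree ?q"
    by (rule degree_map_poly) simp
  then have "map_poly rconst (reflect_poly ?q) = reflect_poly (map_poly rconst ?q)"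
    by (intro poly_eqI) (simp add: coeff_map_poly coeff_reflect_poly)
  moreover have "map_poly rconst ?q = map_poly (\<lambda>c. rconst (cnj c)) p"
    by (simp add: map_poly_map_poly o_def)
  moreover have "degree (map_poly (\<lambda>c. rconst (cnj c)) p) = degree p"
    by (rule degree_map_poly) simp
  ultimately show ?thesis
    by (simp add: recip_conj_def to_fract_conv_poly poly_reflect_poly_nz star_poly_def)
qed

lemma star_poly_eq_0_iff [simp]: "star_poly p = 0 \<longleftrightarrow> p = 0"
  using to_fract_recip_conj[of p] by (metis to_fract_eq_0_iff mult_eq_0_iff power_not_zero
    recip_conj_eq_0_iff rvar_nonzero)

lemma to_fract_monom_1: "to_fract (monom 1 n) = rvar ^ n"
  by (simp add: to_fract_conv_poly map_poly_monom poly_monom)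

text \<open>Each of the two products in \<open>substar_Fract\<close> carries the power of z with
  exponent \<open>degree p + degree q\<close>, so these powers cancel.\<close>

lemma substar_Fract_conv:
  assumes "q \<noteq> 0"
  shows "substar (Fract p q) = star_poly p / star_poly q"
proof -
  have "substar (Fract p q) = to_fract (recip_conj p * monom 1 (degree q)) /
      to_fract (recip_conj q * monom 1 (degree p))"
    unfolding substar_Fract[OF assms] by (rule Fract_conv_to_fract)
  also have "\<dots> = star_poly p / star_poly q"
    by (simp only: to_fract_mult to_fract_recip_conj to_fract_monom_1) (simp add: field_simps)
  finally show ?thesis .
qed

lemma substar_to_fract: "substar (to_fract p) = star_poly p"
  using substar_Fract_conv[of 1 p] by (simp add: to_fract_def one_pCons)

lemma substar_add: "substar (f + g) = substar f + substar g"
proof (cases f)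
  case f: (Fract p q)
  show ?thesis
  proof (cases g)
    case g: (Fract s t)
    show ?thesis using f g
      by (simp add: substar_Fract_conv star_poly_add star_poly_mult add_frac_eq)
  qed
qed

lemma substar_mult: "substar (f * g) = substar f * substar g"
proof (cases f)
  case f: (Fract p q)
  show ?thesis
  proof (cases g)
    case g: (Fract s t)
    show ?thesis using f g
      by (simp add: substar_Fract_conv star_poly_mult)
  qed
qed

lemma substar_divide: "substar (f / g) = substar f / substar g"
proof (cases f)
  case f: (Fract p q)
  show ?thesis
  proof (cases g)
    case g: (Fract s t)
    show ?thesis
    proof (cases "s = 0")
      \<comment> \<open>Here g = 0, and division by zero gives 0 on both sides.\<close>
      case True
      then show ?thesis
        using g substar_to_fract[of 0] by (simp add: Zero_fract_def[symmetric] fract_collapse)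
    next
      case False
      then show ?thesis using f g
        by (simp add: substar_Fract_conv star_poly_mult)
    qed
  qed
qed

lemma substar_rconst: "substar (rconst c) = rconst (cnj c)"
  using substar_to_fract[of "[:c:]"] by (simp add: rconst_def)

lemma substar_rscale: "substar (rscale c f) = rscale (cnj c) (substar f)"
  by (simp add: rscale_def substar_mult substar_rconst)

text \<open>The substar of \<open>pCons 0 t\<close> contributes a factor 1/z, and (a + b z)/z = b +
  a/z is the substar of the reversed conjugate factor.\<close>

lemma linear_mult_substar:
  "to_fract [:a, b:] * substar (to_fract (pCons 0 t) / D) =
    substar (to_fract ([:cnj b, cnj a:] * t) / D)"
  by (simp only: substar_divide substar_to_fract star_poly_mult)
     (simp add: to_fract_pCons field_simps)

text \<open>Newton interpolation: match q at x, divide by z - x, then match the quotient at y. Since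
  the second step uses the quotient, x = y is allowed.\<close>

lemma linear_interpolation:
  fixes p q :: "complex poly"
  assumes "poly p x \<noteq> 0" "poly p y \<noteq> 0"
  obtains s0 s1 t where "q = [:s0, s1:] * p + [:-x, 1:] * [:-y, 1:] * t"
proof -
  define c where "c = poly q x / poly p x"
  have "poly (q - smult c p) x = 0"
    using assms by (simp add: c_def)
  then obtain q1 where q1: "q - smult c p = [:-x, 1:] * q1"
    unfolding poly_eq_0_iff_dvd by (elim dvdE)
  define d where "d = poly q1 y / poly p y"
  have "poly (q1 - smult d p) y = 0"
    using assms by (simp add: d_def)
  then obtain t where t: "q1 - smult d p = [:-y, 1:] * t"
    unfolding poly_eq_0_iff_dvd by (elim dvdE)
  have "[:c - d * x, d:] = [:c:] + [:-x, 1:] * [:d:]"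
    by (simp add: algebra_simps)
  moreover have "smult c p = [:c:] * p" "smult d p = [:d:] * p"
    by simp_all
  ultimately have "q = [:c - d * x, d:] * p + [:-x, 1:] * [:-y, 1:] * t"
    using q1 t by algebra
  then show thesis by (rule that)
qed

section \<open>A uniform description of the poles\<close>

text \<open>
  \<open>pole k\<close> is \<open>\<ell>\<^sub>k\<close> and \<open>copole k\<close> is \<open>\<ell>\<^sub>k\<^sup>*\<close>. The index \<open>0\<close> is not a pole (\<open>\<ell>\<^sub>0\<close> may be constant); only
  \<open>\<ell>\<^sub>0\<^sup>*\<close> enters, and it is the factor \<open>z - \<beta>\<^sub>0 = z\<close> of the recurrence.
\<close>

locale pole_sequence =
  fixes a b :: "nat \<Rightarrow> complex"
  assumes a_nonzero: "a n \<noteq> 0"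
    and b_nonzero: "n \<ge> 1 \<Longrightarrow> b n \<noteq> 0"
begin

definition pole :: "nat \<Rightarrow> complex poly" where
  "pole n = [:a n, b n:]"

definition copole :: "nat \<Rightarrow> complex poly" where
  "copole n = [:cnj (b n), cnj (a n):]"

text \<open>Numerators of degree at most n parametrize the n-th space, so that arguments about
  functions become polynomial divisions and degree counts.\<close>

definition over_poles :: "nat \<Rightarrow> complex poly \<Rightarrow> ratfun" where
  "over_poles n p = to_fract p / (\<Prod>k=1..n. to_fract (pole k))"

lemma pole_nonzero [simp]: "pole n \<noteq> 0"
  using a_nonzero by (simp add: pole_def)

lemma copole_nonzero [simp]: "copole n \<noteq> 0"
  using a_nonzero by (simp add: copole_def)

lemma degree_pole: "n \<ge> 1 \<Longrightarrow> degree (pole n) = 1"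
  using b_nonzero by (simp add: pole_def)

lemma degree_copole: "degree (copole n) = 1"
  using a_nonzero by (simp add: copole_def)

lemma over_poles_Suc: "over_poles (Suc n) p = over_poles n p / to_fract (pole (Suc n))"
  by (simp add: over_poles_def prod.nat_ivl_Suc')

lemma over_poles_pole_mult: "over_poles (Suc n) (pole (Suc n) * p) = over_poles n p"
  by (simp add: over_poles_Suc) (simp add: over_poles_def)

lemma over_poles_add: "over_poles n (p + q) = over_poles n p + over_poles n q"
  by (simp add: over_poles_def add_divide_distrib)

lemma over_poles_mult: "over_poles n (p * q) = to_fract p * over_poles n q"
  by (simp add: over_poles_def)

lemma over_poles_smult: "over_poles n (smult c p) = rscale c (over_poles n p)"
  using over_poles_mult[of n "[:c:]" p] by (simp add: rscale_def rconst_def)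

lemma over_poles_eq_iff [simp]: "over_poles n p = over_poles n q \<longleftrightarrow> p = q"
  by (simp add: over_poles_def)

lemma pole_mult_substar:
  "to_fract (pole k) * substar (over_poles n (pCons 0 t)) = substar (over_poles n (copole k * t))"
  unfolding pole_def copole_def over_poles_def by (rule linear_mult_substar)

lemma copole_mult_substar:
  "to_fract (copole k) * substar (over_poles n (pCons 0 t)) = substar (over_poles n (pole k * t))"
  using linear_mult_substar[of "cnj (b k)" "cnj (a k)"]
  by (simp add: pole_def copole_def over_poles_def)

lemma degree_pole_mult_le: "degree t \<le> n \<Longrightarrow> degree (pole k * t) \<le> Suc n"
  using degree_mult_le[of "pole k" t] by (simp add: pole_def split: if_splits)

lemma degree_copole_mult_le: "degree t \<le> n \<Longrightarrow> degree (copole k * t) \<le> Suc n"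
  using degree_mult_le[of "copole k" t] by (simp add: degree_copole)

end

text \<open>\<open>r_pole\<close> and \<open>r_copole\<close> are nonvanishing at the zeros of
  \<open>pole n\<close> and \<open>copole n\<close>; the numerator in \<open>r_copole\<close> has
  index one higher than the factor.\<close>

locale orthonormal_rational_functions = pole_sequence +
  fixes F :: "ratfun \<Rightarrow> complex"
    and L :: "ratfun set"
    and r :: "nat \<Rightarrow> complex poly"
  assumes L_subspace: "ratfun.subspace L"
    and F_linear: "linear_functional_on (ratfun.span {f * substar g |f g. f \<in> L \<and> g \<in> L}) F"
    and F_definite: "h \<in> L \<Longrightarrow> h \<noteq> 0 \<Longrightarrow> F (h * substar h) \<noteq> 0"
    and r_degree: "degree (r n) \<le> n"
    and r_in_L: "over_poles n (r n) \<in> L"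
    and orthonormal:
      "F (over_poles m (r m) * substar (over_poles n (r n))) = (if m = n then 1 else 0)"
    and r_pole: "n \<ge> 1 \<Longrightarrow> poly (r n) (- a n / b n) \<noteq> 0"
    and r_copole: "poly (r (Suc n)) (- cnj (b n) / cnj (a n)) \<noteq> 0"
begin

abbreviation "\<phi> n \<equiv> over_poles n (r n)"

section \<open>Orthogonality and the three-term recurrence in terms of numerators\<close>

lemma F_add:
  assumes "f \<in> L" "g \<in> L" "f' \<in> L" "g' \<in> L"
  shows "F (f * substar g + f' * substar g') = F (f * substar g) + F (f' * substar g')"
  using assms F_linear unfolding linear_functional_on_def by (blast intro: ratfun.span_base)

lemma F_scale:
  assumes "f \<in> L" "g \<in> L"
  shows "F (rscale c (f * substar g)) = c * F (f * substar g)"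
  using assms F_linear unfolding linear_functional_on_def by (blast intro: ratfun.span_base)

lemma F_linear_left:
  assumes "f \<in> L" "g \<in> L" "h \<in> L"
  shows "F ((f + rscale c g) * substar h) = F (f * substar h) + c * F (g * substar h)"
  using F_add[of f h "rscale c g" h] F_scale[of g h c] assms
    ratfun.subspace_scale[OF L_subspace]
  by (simp add: rscale_def algebra_simps)

lemma F_linear_right:
  assumes "f \<in> L" "g \<in> L" "h \<in> L"
  shows "F (h * substar (f + rscale c g)) = F (h * substar f) + cnj c * F (h * substar g)"
  using F_add[of h f h "rscale c g"] F_scale[of h g "cnj c"] assms
    ratfun.subspace_scale[OF L_subspace]
  by (simp add: rscale_def substar_add substar_mult substar_rconst algebra_simps)

lemma F_scale_right:
  assumes "f \<in> L" "g \<in> L"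
  shows "F (f * substar (rscale c g)) = cnj c * F (f * substar g)"
  using F_scale[OF assms, of "cnj c"] by (simp add: substar_rscale) (simp add: rscale_def mult_ac)

text \<open>By \<open>r_pole\<close> some multiple of \<open>r (Suc n)\<close> agrees with p at the
  zero of the last pole factor. The difference is divisible by that factor, and cancelling it drops
  one level.\<close>

lemma over_poles_reduce:
  assumes "degree p \<le> Suc n"
  obtains c q where "degree q \<le> n"
    "over_poles (Suc n) p = over_poles n q + rscale c (\<phi> (Suc n))"
proof -
  let ?x = "- a (Suc n) / b (Suc n)"
  define c where "c = poly p ?x / poly (r (Suc n)) ?x"
  have b: "b (Suc n) \<noteq> 0"
    by (simp add: b_nonzero)
  have "poly (p - smult c (r (Suc n))) ?x = 0"
    using r_pole[of "Suc n"] by (simp add: c_def)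
  then have "[:- ?x, 1:] dvd p - smult c (r (Suc n))"
    unfolding poly_eq_0_iff_dvd .
  moreover have "pole (Suc n) = smult (b (Suc n)) [:- ?x, 1:]"
    using b by (simp add: pole_def)
  ultimately have "pole (Suc n) dvd p - smult c (r (Suc n))"
    using b by (simp only: smult_dvd_iff) simp
  then obtain q where q: "p - smult c (r (Suc n)) = pole (Suc n) * q"
    by (elim dvdE)
  then have p: "p = smult c (r (Suc n)) + pole (Suc n) * q"
    by (simp add: algebra_simps)
  have "degree (pole (Suc n) * q) \<le> Suc n"
    unfolding q[symmetric] using assms r_degree[of "Suc n"]
    by (intro degree_diff_le) (auto intro: order.trans[OF degree_smult_le])
  then have "degree q \<le> n"
    by (cases "q = 0") (simp_all add: degree_mult_eq degree_pole)
  moreover have "over_poles (Suc n) p = over_poles n q + rscale c (\<phi> (Suc n))"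
    unfolding p by (simp only: over_poles_add over_poles_smult over_poles_pole_mult add.commute)
  ultimately show thesis
    by (rule that)
qed

lemma over_poles_0_eq:
  assumes "degree p = 0"
  obtains c where "over_poles 0 p = rscale c (\<phi> 0)"
proof -
  obtain c where c: "p = [:c:]"
    using assms by (auto elim: degree_eq_zeroE)
  obtain c0 where c0: "r 0 = [:c0:]"
    using r_degree[of 0] by (auto elim: degree_eq_zeroE)
  \<comment> \<open>Otherwise \<open>\<phi> 0\<close> would be 0, against its norm 1.\<close>
  have "r 0 \<noteq> 0"
  proof
    assume "r 0 = 0"
    with orthonormal[of 0 0] F_scale[of "\<phi> 0" "\<phi> 0" 0] r_in_L[of 0] show False
      by (simp add: over_poles_def rscale_def)
  qed
  with c0 have "p = smult (c / c0) (r 0)"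
    using c by simp
  then show thesis
    using that over_poles_smult by blast
qed

lemma over_poles_in_L: "degree p \<le> n \<Longrightarrow> over_poles n p \<in> L"
proof (induction n arbitrary: p)
  case 0
  then obtain c where "over_poles 0 p = rscale c (\<phi> 0)"
    using over_poles_0_eq by blast
  then show ?case
    using r_in_L ratfun.subspace_scale[OF L_subspace] by simp
next
  case (Suc n)
  from Suc.prems obtain c q where "degree q \<le> n"
      "over_poles (Suc n) p = over_poles n q + rscale c (\<phi> (Suc n))"
    by (rule over_poles_reduce)
  with Suc.IH[of q] show ?case
    using r_in_L ratfun.subspace_scale[OF L_subspace] ratfun.subspace_add[OF L_subspace] by simp
qed

lemma orthogonal:
  assumes "degree p \<le> n" "n < m"
  shows "F (\<phi> m * substar (over_poles n p)) = 0"
  using assms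
proof (induction n arbitrary: p)
  case 0
  then obtain c where "over_poles 0 p = rscale c (\<phi> 0)"
    using over_poles_0_eq by blast
  with 0 show ?case
    by (simp add: F_scale_right r_in_L orthonormal)
next
  case (Suc n)
  from Suc.prems(1) obtain c q where q: "degree q \<le> n"
      "over_poles (Suc n) p = over_poles n q + rscale c (\<phi> (Suc n))"
    by (rule over_poles_reduce)
  with Suc.IH[of q] Suc.prems show ?case
    by (simp add: F_linear_right over_poles_in_L r_in_L orthonormal)
qed

text \<open>After subtracting a multiple of \<open>\<phi> n\<close>, the rest lies one level lower
  and is orthogonal to itself, so it vanishes by definiteness. At level 0 everything is already a
  multiple of \<open>\<phi> 0\<close>.\<close>

lemma orthogonal_imp_multiple:
  assumes "degree p \<le> n"
    and orth: "\<And>k t. n = Suc k \<Longrightarrow> degree t \<le> k \<Longrightarrow>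
      F (over_poles n p * substar (over_poles k t)) = 0"
  obtains c where "over_poles n p = rscale c (\<phi> n)"
proof (cases n)
  case 0
  with assms that show thesis
    using over_poles_0_eq by blast
next
  case (Suc k)
  obtain c q where q: "degree q \<le> k" "over_poles n p = over_poles k q + rscale c (\<phi> n)"
    using over_poles_reduce assms(1) Suc by metis
  let ?h = "over_poles k q"
  have "F (over_poles n p * substar ?h) = F (?h * substar ?h) + c * F (\<phi> n * substar ?h)"
    unfolding q by (rule F_linear_left) (simp_all add: over_poles_in_L q r_in_L)
  moreover have "F (over_poles n p * substar ?h) = 0"
    using Suc q by (intro orth)
  moreover have "F (\<phi> n * substar ?h) = 0"
    using Suc q by (intro orthogonal) auto
  ultimately have "F (?h * substar ?h) = 0"
    by simp
  then have "?h = 0"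
    using F_definite over_poles_in_L q(1) by blast
  with q that show thesis
    by (metis add_0)
qed

text \<open>Moving the linear factors to the second argument leaves no contribution from
  \<open>\<phi> N\<close>, whose partner sits at level \<open>Suc n < N\<close>. This serves both to
  test the remainder for orthogonality and, with X = 0, to exclude its vanishing.\<close>

lemma F_remainder:
  assumes eq: "to_fract (pole N) * \<phi> N =
      (rconst e + rconst d * to_fract (copole m)) * \<phi> m + X"
    and t: "degree t \<le> n" "Suc n < N"
  shows "F (X * substar (over_poles (Suc n) (pCons 0 t))) =
    - (e * F (\<phi> m * substar (over_poles (Suc n) (pCons 0 t))) +
       d * F (\<phi> m * substar (over_poles (Suc n) (pole m * t))))"
proof -
  let ?h = "over_poles (Suc n)"
  have L: "?h (pCons 0 t) \<in> L" "?h (pole m * t) \<in> L" "?h (copole N * t) \<in> L"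
    using t by (auto intro!: over_poles_in_L degree_pole_mult_le degree_copole_mult_le
      order.trans[OF degree_pCons_le])
  note L' = ratfun.subspace_scale[OF L_subspace] ratfun.subspace_add[OF L_subspace]
  \<comment> \<open>X is not assumed to lie in L, so its pairing is first rewritten as a sum of two
    products of elements of L; the coefficients are conjugated because substar conjugates them
    back.\<close>
  define g where "g = rscale (- cnj e) (?h (pCons 0 t)) + rscale (- cnj d) (?h (pole m * t))"
  have "X * substar (?h (pCons 0 t)) =
      \<phi> N * (to_fract (pole N) * substar (?h (pCons 0 t)))
      - rconst e * \<phi> m * substar (?h (pCons 0 t))
      - rconst d * \<phi> m * (to_fract (copole m) * substar (?h (pCons 0 t)))"
    using eq by algebra
  also have "\<dots> = \<phi> N * substar (?h (copole N * t)) + \<phi> m * substar g"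
    unfolding pole_mult_substar copole_mult_substar g_def substar_add substar_rscale
    by (simp add: rscale_def rconst_minus algebra_simps)
  also have "F \<dots> = F (\<phi> N * substar (?h (copole N * t))) + F (\<phi> m * substar g)"
    unfolding g_def using L by (intro F_add L') (simp_all add: r_in_L)
  also have "F (\<phi> N * substar (?h (copole N * t))) = 0"
    using t by (intro orthogonal degree_copole_mult_le)
  also have "F (\<phi> m * substar g) = - (e * F (\<phi> m * substar (?h (pCons 0 t))) +
       d * F (\<phi> m * substar (?h (pole m * t))))"
    unfolding g_def using L L'
    by (subst F_linear_right)
      (simp_all add: r_in_L F_scale_right del: ratfun.scale_minus_left)
  finally show ?thesis
    by simp
qed

lemma remainder_factorization:
  obtains e d t where "degree t \<le> k"
    "r (Suc (Suc k)) = ([:e:] + smult d (copole (Suc k))) * r (Suc k) +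
      copole k * (pole (Suc k) * t)"
proof -
  let ?x = "- cnj (b k) / cnj (a k)" and ?y = "- a (Suc k) / b (Suc k)"
  have nz: "a k \<noteq> 0" "a (Suc k) \<noteq> 0" "b (Suc k) \<noteq> 0"
    by (simp_all add: a_nonzero b_nonzero)
  obtain s0 s1 t where t: "r (Suc (Suc k)) = [:s0, s1:] * r (Suc k) + [:-?x, 1:] * [:-?y, 1:] * t"
    by (rule linear_interpolation[OF r_copole[of k] r_pole[of "Suc k"]]) auto
  \<comment> \<open>\<open>e\<close> and \<open>d\<close> rewrite s0 + s1 z in the basis 1,
    \<open>copole (Suc k)\<close>; \<open>u\<close> absorbs the leading coefficients of
    \<open>copole k\<close> and \<open>pole (Suc k)\<close>.\<close>
  define d where "d = s1 / cnj (a (Suc k))"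
  define e where "e = s0 - d * cnj (b (Suc k))"
  define u where "u = smult (1 / (cnj (a k) * b (Suc k))) t"
  have s: "[:s0, s1:] = [:e:] + smult d (copole (Suc k))"
    using nz by (simp add: d_def e_def copole_def)
  have "copole k * (pole (Suc k) * u) =
      smult (cnj (a k)) [:-?x, 1:] * (smult (b (Suc k)) [:-?y, 1:] * u)"
    using nz by (simp add: copole_def pole_def)
  also have "\<dots> = [:-?x, 1:] * [:-?y, 1:] * t"
    unfolding u_def mult_smult_left mult_smult_right smult_smult
    using nz by (simp add: mult.assoc del: mult_pCons_left)
  finally have rN: "r (Suc (Suc k)) =
      ([:e:] + smult d (copole (Suc k))) * r (Suc k) + copole k * (pole (Suc k) * u)"
    using t unfolding s by simp
  have "degree ([:s0, s1:] * r (Suc k)) \<le> Suc (Suc k)"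
    using degree_mult_le[of "[:s0, s1:]" "r (Suc k)"] r_degree[of "Suc k"]
    by (simp split: if_splits)
  moreover have "copole k * (pole (Suc k) * u) = r (Suc (Suc k)) - [:s0, s1:] * r (Suc k)"
    unfolding rN s by simp
  \<comment> \<open>Both factors in front of \<open>u\<close> have degree exactly one, which leaves
    degree k for \<open>u\<close>.\<close>
  ultimately have "degree (copole k * (pole (Suc k) * u)) \<le> Suc (Suc k)"
    using r_degree[of "Suc (Suc k)"] by (metis degree_diff_le)
  then have "degree u \<le> k"
    by (cases "u = 0") (simp_all add: degree_mult_eq degree_pole degree_copole)
  then show thesis
    using rN that by blast
qed

theorem three_term_recurrence:
  obtains e d c where "c \<noteq> 0"
    "to_fract (pole (Suc (Suc k))) * \<phi> (Suc (Suc k)) =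
      (rconst e + rconst d * to_fract (copole (Suc k))) * \<phi> (Suc k) +
      rconst c * to_fract (copole k) * \<phi> k"
proof -
  let ?m = "Suc k" and ?N = "Suc (Suc k)"
  obtain e d t where t: "degree t \<le> k"
    and rN: "r ?N = ([:e:] + smult d (copole ?m)) * r ?m + copole k * (pole ?m * t)"
    by (rule remainder_factorization)
  have "to_fract (pole ?N) * \<phi> ?N = over_poles ?m (r ?N)"
    by (simp add: over_poles_Suc)
  also have "\<dots> = to_fract ([:e:] + smult d (copole ?m)) * \<phi> ?m +
      to_fract (copole k) * over_poles k t"
    unfolding rN over_poles_add over_poles_mult[of ?m "copole k"] over_poles_pole_mult
    by (simp only: over_poles_mult)
  also have "to_fract ([:e:] + smult d (copole ?m)) = rconst e + rconst d * to_fract (copole ?m)"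
    unfolding to_fract_add rconst_def to_fract_mult[symmetric] by simp
  finally have eq: "to_fract (pole ?N) * \<phi> ?N =
      (rconst e + rconst d * to_fract (copole ?m)) * \<phi> ?m + to_fract (copole k) * over_poles k t" .

  \<comment> \<open>Expanding \<open>over_poles j s\<close> by \<open>pole k\<close> and moving that
    factor to the left produces \<open>copole k\<close>, hence the full remainder.
    \<open>F_remainder\<close> then leaves pairings of \<open>\<phi> (Suc k)\<close> with level k,
    which vanish.\<close>
  have "F (over_poles k t * substar (over_poles j s)) = 0" if "k = Suc j" "degree s \<le> j" for j s
  proof -
    have "over_poles k t * substar (over_poles j s) =
        to_fract (copole k) * over_poles k t * substar (over_poles k (pCons 0 s))"
      using copole_mult_substar[of k k s] unfolding that(1) over_poles_pole_mult by simp
    also have "F \<dots> = - (e * F (\<phi> ?m * substar (over_poles k (pCons 0 s))) +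
        d * F (\<phi> ?m * substar (over_poles k (pole ?m * s))))"
      unfolding that(1) using eq that by (intro F_remainder) auto
    also have "\<dots> = 0"
      using that degree_pole_mult_le[of s j ?m] degree_pCons_le[of 0 s] by (simp add: orthogonal)
    finally show ?thesis .
  qed
  with t obtain c where c: "over_poles k t = rscale c (\<phi> k)"
    by (rule orthogonal_imp_multiple)

  have "c \<noteq> 0"
  proof
    assume "c = 0"
    with c have "over_poles k t = over_poles k 0"
      by (simp add: rscale_def) (simp add: over_poles_def)
    then have [simp]: "t = 0"
      by simp
    \<comment> \<open>With t = 0, \<open>r ?N\<close> equals \<open>e\<close> times
      \<open>r ?m\<close> at the zero of \<open>copole ?m\<close>, and regularity makes that value
      nonzero.\<close>
    have "poly (copole ?m) (- cnj (b ?m) / cnj (a ?m)) = 0"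
      using a_nonzero by (simp add: copole_def)
    with r_copole[of ?m] rN have e: "e \<noteq> 0"
      by auto
    \<comment> \<open>The constant terms are matched using \<open>a ?m\<close>, the value of
      \<open>pole ?m\<close> at 0. In the second summand the pole cancels, so it lies at level k and
      is orthogonal to \<open>\<phi> ?m\<close>.\<close>
    obtain x p where rm: "r ?m = pCons 0 p + smult x (pole ?m)"
    proof
      let ?x = "coeff (r ?m) 0 / a ?m"
      have "r ?m - smult ?x (pole ?m) = pCons 0 (poly_shift 1 (r ?m - smult ?x (pole ?m)))"
        using a_nonzero[of ?m]
        by (intro poly_eqI) (simp add: coeff_pCons coeff_poly_shift pole_def split: nat.split)
      then show "r ?m = pCons 0 (poly_shift 1 (r ?m - smult ?x (pole ?m))) + smult ?x (pole ?m)"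
        by (simp add: algebra_simps)
    qed
    have "degree (pCons 0 p) \<le> ?m"
    proof -
      have "pCons 0 p = r ?m - smult x (pole ?m)"
        using rm by simp
      moreover have "degree (smult x (pole ?m)) \<le> ?m"
        using degree_smult_le[of x "pole ?m"] by (simp add: pole_def split: if_splits)
      ultimately show ?thesis
        using r_degree[of ?m] by (metis degree_diff_le)
    qed
    then have p: "degree p \<le> k"
      by (cases "p = 0") auto
    \<comment> \<open>The zero remainder is tested against the first summand. Since e \<noteq> 0,
      \<open>\<phi> ?m\<close> is orthogonal to it too, hence to itself, contradicting its norm
      1.\<close>
    have "F (0 * substar (over_poles ?m (pCons 0 p))) =
      - (e * F (\<phi> ?m * substar (over_poles ?m (pCons 0 p))) +
         d * F (\<phi> ?m * substar (over_poles ?m (pole ?m * p))))"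
      using eq p by (intro F_remainder) (auto simp: over_poles_def)
    moreover have "F (\<phi> ?m * substar (over_poles ?m (pole ?m * p))) = 0"
      unfolding over_poles_pole_mult using p by (intro orthogonal) auto
    moreover have "F 0 = 0"
      using F_scale[OF r_in_L r_in_L, of 0] by (simp add: rscale_def)
    ultimately have "F (\<phi> ?m * substar (over_poles ?m (pCons 0 p))) = 0"
      using e by simp
    moreover have "\<phi> ?m = over_poles ?m (pCons 0 p) + rscale x (over_poles k 1)"
      using over_poles_pole_mult[of k 1]
      by (subst rm) (simp add: over_poles_add over_poles_smult)
    then have "F (\<phi> ?m * substar (\<phi> ?m)) =
        F (\<phi> ?m * substar (over_poles ?m (pCons 0 p))) + cnj x * F (\<phi> ?m * substar (over_poles k 1))"
      using p order.trans[OF degree_pCons_le[of 0 p]]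
      by (metis F_linear_right over_poles_in_L r_in_L degree_1 le0 Suc_le_mono)
    moreover have "F (\<phi> ?m * substar (over_poles k 1)) = 0"
      by (intro orthogonal) auto
    ultimately show False
      using orthonormal[of ?m ?m] by simp
  qed
  then show thesis
    using eq unfolding c rscale_def by (intro that) (simp_all add: mult_ac)
qed

end


section \<open>Specialization to the alternating poles\<close>

lemma Lspace_eq_span: "Lspace \<alpha> \<beta> = ratfun.span (range (ubasis \<alpha> \<beta>))"
proof
  show "Lspace \<alpha> \<beta> \<subseteq> ratfun.span (range (ubasis \<alpha> \<beta>))"
    unfolding Lspace_def Lspace_upto_def by (intro UN_least ratfun.span_mono) auto
  have "f \<in> Lspace \<alpha> \<beta>" if "f \<in> ratfun.span (range (ubasis \<alpha> \<beta>))" for f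
    using that
  proof (induction rule: ratfun.span_induct_alt)
    case base
    show ?case
      unfolding Lspace_def Lspace_upto_def using ratfun.span_zero by blast
  next
    case (step c x y)
    then obtain k n where k: "x = ubasis \<alpha> \<beta> k" and n: "y \<in> Lspace_upto \<alpha> \<beta> n"
      by (auto simp: Lspace_def)
    \<comment> \<open>The spaces increase with the index, so both summands fit into the one with the
      larger index.\<close>
    have "x \<in> Lspace_upto \<alpha> \<beta> (max k n)"
      unfolding k Lspace_upto_def by (intro ratfun.span_base) auto
    moreover have "Lspace_upto \<alpha> \<beta> n \<subseteq> Lspace_upto \<alpha> \<beta> (max k n)"
      unfolding Lspace_upto_def by (intro ratfun.span_mono) auto
    ultimately have "rscale c x + y \<in> Lspace_upto \<alpha> \<beta> (max k n)"
      using n unfolding Lspace_upto_def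
      by (intro ratfun.span_add ratfun.span_scale) auto
    then show ?case
      by (auto simp: Lspace_def)
  qed
  then show "ratfun.span (range (ubasis \<alpha> \<beta>)) \<subseteq> Lspace \<alpha> \<beta>"
    by blast
qed

lemma gram_schmidt_in_span:
  assumes "gram_schmidt_of F u \<phi>"
  shows "\<phi> n \<in> ratfun.span (range u)"
proof (induction n rule: less_induct)
  case (less n)
  obtain \<kappa> where "\<phi> n = rscale \<kappa> (u n - (\<Sum>k<n. rscale (rinner F (u n) (\<phi> k)) (\<phi> k)))"
    using assms unfolding gram_schmidt_of_def by blast
  then show ?case
    using less
    by (auto intro!: ratfun.span_scale ratfun.span_diff ratfun.span_sum ratfun.span_base[OF rangeI])
qed

text \<open>Matches the single product of pole factors with the two separate products of the given
  denominators.\<close>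

lemma prod_alternating:
  fixes f g h :: "nat \<Rightarrow> 'a::comm_monoid_mult"
  assumes "\<And>j. h (2 * j) = g j" "\<And>j. h (2 * j + 1) = f (j + 1)"
  shows "(\<Prod>k=1..2*j. h k) = (\<Prod>k=1..j. f k) * (\<Prod>k=1..j. g k)"
    and "(\<Prod>k=1..2*j+1. h k) = (\<Prod>k=1..j+1. f k) * (\<Prod>k=1..j. g k)"
proof -
  show even: "(\<Prod>k=1..2*j. h k) = (\<Prod>k=1..j. f k) * (\<Prod>k=1..j. g k)" for j
  proof (induction j)
    case (Suc j)
    then show ?case
      using assms(1)[of "Suc j"] assms(2)[of j] by (simp add: mult_ac)
  qed simp
  show "(\<Prod>k=1..2*j+1. h k) = (\<Prod>k=1..j+1. f k) * (\<Prod>k=1..j. g k)"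
    using even[of j] assms(2)[of j] by (simp add: mult_ac)
qed

theorem theorem2p1:
  fixes \<alpha> \<beta> :: "nat \<Rightarrow> complex"
    and F :: "ratfun \<Rightarrow> complex"
    and \<phi> :: "nat \<Rightarrow> ratfun"
    and r :: "nat \<Rightarrow> complex poly"
  assumes alpha_nz: "\<And>j. j \<ge> 1 \<Longrightarrow> \<alpha> j \<noteq> 0"
    and beta_nz: "\<And>j. j \<ge> 1 \<Longrightarrow> \<beta> j \<noteq> 0"
    and beta_0: "\<beta> 0 = 0"
    and F_linear: "linear_functional_on (LLstar \<alpha> \<beta>) F"
    and F_hermitian: "hermitian_on (LLstar \<alpha> \<beta>) F"
    and F_pos: "positive_definite_on (Lspace \<alpha> \<beta>) F"
    and F_one: "F 1 = 1"
    and phi_gs: "gram_schmidt_of F (ubasis \<alpha> \<beta>) \<phi>"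
    and phi_on: "orthonormal_seq F \<phi>"
    and phi_0: "\<phi> 0 = 1"
    and r_degree: "\<And>n. degree (r n) \<le> n"
    and r_0: "r 0 = 1"
    and phi_even: "\<And>j. \<phi> (2 * j) = to_fract (r (2 * j)) /
          ((\<Prod>k=1..j. rvar - rconst (\<alpha> k)) * (\<Prod>k=1..j. 1 - rvar * rconst (cnj (\<beta> k))))"
    and phi_odd: "\<And>j. \<phi> (2 * j + 1) = to_fract (r (2 * j + 1)) /
          ((\<Prod>k=1..j+1. rvar - rconst (\<alpha> k)) * (\<Prod>k=1..j. 1 - rvar * rconst (cnj (\<beta> k))))"
    and reg_even: "\<And>n. n \<ge> 1 \<Longrightarrow>
          poly (r (2 * n)) (\<alpha> n) \<noteq> 0 \<and> poly (r (2 * n)) (1 / cnj (\<beta> n)) \<noteq> 0 \<and>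
          poly (r (2 * n)) (\<beta> (n - 1)) \<noteq> 0 \<and> poly (r (2 * n)) (1 / cnj (\<alpha> n)) \<noteq> 0"
    and reg_odd: "\<And>n. poly (r (2 * n + 1)) (\<alpha> (n + 1)) \<noteq> 0 \<and> poly (r (2 * n + 1)) (\<beta> n) \<noteq> 0"
    and reg_odd': "\<And>n. n \<ge> 1 \<Longrightarrow>
          poly (r (2 * n + 1)) (1 / cnj (\<beta> n)) \<noteq> 0 \<and> poly (r (2 * n + 1)) (1 / cnj (\<alpha> n)) \<noteq> 0"
  shows "\<exists>e d c :: nat \<Rightarrow> complex. (\<forall>j\<ge>1. c j \<noteq> 0) \<and>
    (\<forall>n.
      \<phi> (2 * n + 1) =
          (rconst (e (2 * n + 1)) / (rvar - rconst (\<alpha> (n + 1)))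
            + rconst (d (2 * n + 1)) * (rvar - rconst (\<beta> n)) / (rvar - rconst (\<alpha> (n + 1))))
          * \<phi> (2 * n)
        + rconst (c (2 * n + 1)) * ((1 - rvar * rconst (cnj (\<alpha> n))) / (rvar - rconst (\<alpha> (n + 1))))
          * (if n = 0 then 0 else \<phi> (2 * n - 1)) \<and>
      \<phi> (2 * n + 2) =
          (rconst (e (2 * n + 2)) / (1 - rvar * rconst (cnj (\<beta> (n + 1))))
            + rconst (d (2 * n + 2)) * (1 - rvar * rconst (cnj (\<alpha> (n + 1))))
                / (1 - rvar * rconst (cnj (\<beta> (n + 1)))))
          * \<phi> (2 * n + 1)
        + rconst (c (2 * n + 2)) * ((rvar - rconst (\<beta> n)) / (1 - rvar * rconst (cnj (\<beta> (n + 1)))))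
          * \<phi> (2 * n))"
proof -
  \<comment> \<open>Odd indices carry z - \<alpha>, even ones 1 - z \<open>cnj \<beta>\<close>. At
    index 0, \<open>\<beta> 0 = 0\<close> makes the pole factor 1 and the copole factor z.\<close>
  define a where "a n = (if even n then 1 else - \<alpha> (Suc n div 2))" for n
  define b where "b n = (if even n then - cnj (\<beta> (n div 2)) else 1)" for n
  interpret pole_sequence a b
    by unfold_locales (auto simp: a_def b_def alpha_nz beta_nz elim!: evenE oddE)

  have pole_even: "to_fract (pole (2 * j)) = 1 - rvar * rconst (cnj (\<beta> j))" for j
    by (simp add: pole_def a_def b_def to_fract_pCons rconst_minus)
  have pole_odd: "to_fract (pole (2 * j + 1)) = rvar - rconst (\<alpha> (j + 1))" for j
    by (simp add: pole_def a_def b_def to_fract_pCons rconst_minus)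
  have copole_even: "to_fract (copole (2 * j)) = rvar - rconst (\<beta> j)" for j
    by (simp add: copole_def a_def b_def to_fract_pCons rconst_minus)
  have copole_odd: "to_fract (copole (2 * j + 1)) = 1 - rvar * rconst (cnj (\<alpha> (j + 1)))" for j
    by (simp add: copole_def a_def b_def to_fract_pCons rconst_minus)
  note den = prod_alternating[of "\<lambda>n. to_fract (pole n)", OF pole_even pole_odd]
  have phi: "\<phi> n = over_poles n (r n)" for n
  proof (cases "even n")
    case True
    then obtain j where "n = 2 * j" by (elim evenE)
    then show ?thesis
      by (simp only: over_poles_def den phi_even)
  next
    case False
    then obtain j where "n = 2 * j + 1" by (elim oddE)
    then show ?thesis
      by (simp only: over_poles_def den phi_odd)
  qed

  interpret orthonormal_rational_functions a b F "Lspace \<alpha> \<beta>" r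
  proof
    show "ratfun.subspace (Lspace \<alpha> \<beta>)"
      unfolding Lspace_eq_span by (rule ratfun.subspace_span)
    show "linear_functional_on
        (ratfun.span {f * substar g |f g. f \<in> Lspace \<alpha> \<beta> \<and> g \<in> Lspace \<alpha> \<beta>}) F"
      using F_linear unfolding LLstar_def .
    show "F (h * substar h) \<noteq> 0" if "h \<in> Lspace \<alpha> \<beta>" "h \<noteq> 0" for h
      using F_pos that by (auto simp: positive_definite_on_def)
    show "degree (r n) \<le> n" for n
      by (rule r_degree)
    show "over_poles n (r n) \<in> Lspace \<alpha> \<beta>" for n
      unfolding phi[symmetric] Lspace_eq_span using phi_gs by (rule gram_schmidt_in_span)
    show "F (over_poles m (r m) * substar (over_poles n (r n))) = (if m = n then 1 else 0)" for m n
      using phi_on unfolding orthonormal_seq_def rinner_def phi by blast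
    \<comment> \<open>The zero is \<open>1 / cnj (\<beta> j)\<close> for n = 2j and
      \<open>\<alpha> (j + 1)\<close> for n = 2j + 1.\<close>
    show "poly (r n) (- a n / b n) \<noteq> 0" if "n \<ge> 1" for n
    proof (cases "even n")
      case True
      then obtain j where "n = 2 * j" by (elim evenE)
      then show ?thesis
        using that reg_even[of j] by (simp add: a_def b_def)
    next
      case False
      then obtain j where "n = 2 * j + 1" by (elim oddE)
      then show ?thesis
        using reg_odd[of j] by (simp add: a_def b_def)
    qed
    \<comment> \<open>The zero is \<open>\<beta> j\<close> for n = 2j and
      \<open>1 / cnj (\<alpha> (j + 1))\<close> for n = 2j + 1.\<close>
    show "poly (r (Suc n)) (- cnj (b n) / cnj (a n)) \<noteq> 0" for n
    proof (cases "even n")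
      case True
      then obtain j where "n = 2 * j" by (elim evenE)
      then show ?thesis
        using reg_odd[of j] by (simp add: a_def b_def)
    next
      case False
      then obtain j where "n = 2 * j + 1" by (elim oddE)
      then show ?thesis
        using reg_even[of "Suc j"] by (simp add: a_def b_def)
    qed
  qed

  have "\<exists>e d c. c \<noteq> 0 \<and> to_fract (pole (Suc n)) * \<phi> (Suc n) =
      (rconst e + rconst d * to_fract (copole n)) * \<phi> n +
      rconst c * to_fract (copole (n - 1)) * (if n = 0 then 0 else \<phi> (n - 1))" for n
  proof (cases n)
    case 0
    \<comment> \<open>The first relation only expands the linear polynomial \<open>r 1\<close> in 1
      and z, with z = \<open>copole 0\<close>; any nonzero c will do, and 1 is chosen.\<close>
    obtain e p where p: "r 1 = pCons e p"
      by (cases "r 1")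
    then have "degree p = 0"
      using r_degree[of 1] by (cases "p = 0") simp_all
    then obtain d where "r 1 = [:e, d:]"
      using p by (auto elim: degree_eq_zeroE)
    then have "to_fract (r 1) = rconst e + rconst d * rvar"
      by (simp add: to_fract_pCons)
    moreover have "to_fract (pole 1) * \<phi> 1 = to_fract (r 1)"
      by (simp add: phi over_poles_def)
    moreover have "to_fract (copole 0) = rvar"
      using copole_even[of 0] beta_0 by simp
    ultimately show ?thesis
      using 0 phi_0 by (intro exI[of _ e] exI[of _ d] exI[of _ 1]) simp
  next
    case (Suc k)
    then show ?thesis
      unfolding phi by (auto intro: three_term_recurrence[of k])
  qed
  then obtain e d c where c: "\<And>n. c n \<noteq> 0"
    and rec: "\<And>n. to_fract (pole (Suc n)) * \<phi> (Suc n) =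
      (rconst (e n) + rconst (d n) * to_fract (copole n)) * \<phi> n +
      rconst (c n) * to_fract (copole (n - 1)) * (if n = 0 then 0 else \<phi> (n - 1))"
    by metis
  have solve: "\<phi> (Suc n) =
      (rconst (e n) / to_fract (pole (Suc n)) +
       rconst (d n) * to_fract (copole n) / to_fract (pole (Suc n))) * \<phi> n +
      rconst (c n) * (to_fract (copole (n - 1)) / to_fract (pole (Suc n))) *
        (if n = 0 then 0 else \<phi> (n - 1))" for n
  proof -
    have "\<phi> (Suc n) = to_fract (pole (Suc n)) * \<phi> (Suc n) / to_fract (pole (Suc n))"
      by simp
    then show ?thesis
      unfolding rec by (simp only: add_divide_distrib distrib_right times_divide_eq_left
        times_divide_eq_right)
  qed
  have odd: "\<phi> (2 * n + 1) =
      (rconst (e (2 * n)) / (rvar - rconst (\<alpha> (n + 1)))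
        + rconst (d (2 * n)) * (rvar - rconst (\<beta> n)) / (rvar - rconst (\<alpha> (n + 1)))) * \<phi> (2 * n)
      + rconst (c (2 * n)) * ((1 - rvar * rconst (cnj (\<alpha> n))) / (rvar - rconst (\<alpha> (n + 1))))
        * (if n = 0 then 0 else \<phi> (2 * n - 1))" for n
  proof (cases n)
    \<comment> \<open>The truncated index \<open>n - 1\<close> and the factor with
      \<open>\<alpha> 0\<close> are harmless here: both stand in a product with 0.\<close>
    case 0
    then show ?thesis
      using solve[of 0] pole_odd[of 0] copole_even[of 0] by simp
  next
    case (Suc j)
    then show ?thesis
      using solve[of "2 * n"] pole_odd[of n] copole_even[of n] copole_odd[of j] by simp
  qed
  have even: "\<phi> (2 * n + 2) =
      (rconst (e (2 * n + 1)) / (1 - rvar * rconst (cnj (\<beta> (n + 1))))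
        + rconst (d (2 * n + 1)) * (1 - rvar * rconst (cnj (\<alpha> (n + 1))))
            / (1 - rvar * rconst (cnj (\<beta> (n + 1))))) * \<phi> (2 * n + 1)
      + rconst (c (2 * n + 1)) * ((rvar - rconst (\<beta> n)) / (1 - rvar * rconst (cnj (\<beta> (n + 1)))))
        * \<phi> (2 * n)" for n
    using solve[of "2 * n + 1"] pole_even[of "n + 1"] copole_even[of n] copole_odd[of n] by simp
  \<comment> \<open>The coefficients \<open>e n\<close>, \<open>d n\<close>, \<open>c n\<close>
    produce \<open>\<phi> (Suc n)\<close>, so the stated sequences are shifted by one.\<close>
  show ?thesis
    using c odd even
    by (intro exI[of _ "\<lambda>j. e (j - 1)"] exI[of _ "\<lambda>j. d (j - 1)"] exI[of _ "\<lambda>j. c (j - 1)"])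
      simp
qed

end
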